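(* Let $G$ be a finite-dimensional Lie group with Lie algebra $\mathfrak g$ and $\tau:\mathfrak g\to G$ a retraction map. Suppose the Hamiltonians on $T^*G$ are left $G$-invariant, so that they are given by smooth reduced Hamiltonians $h,h_1,\dots,h_N:\mathfrak g^*\to\mathbb R$. Then the discrete stochastic flow $\mathcal F^{\rm red}_{0,T}:\mathfrak g^*\to\mathfrak g^*$, $\mu_0\mapsto\mu_M$, of the reduced stochastic midpoint scheme (described in the context) preserves the coadjoint orbits in $\mathfrak g^*$: for all $k$, $\mathcal O(\mu_k)=\mathcal O(\mu_0)$, where $\mu_k$ is the trivialized momentum at step $k$ and $\mathcal O(\mu)=\{\mathrm{Ad}^*_g\mu\mid g\in G\}$. In particular, Casimir functions of the Lie–Poisson bracket on $\mathfrak g^*$ are constant along the discrete stochastic flow.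
   Context: Conventions. A retraction map $\tau:\mathfrak g\to G$ is a local diffeomorphism (near $0$) with $\tau(0)=e$. For $\xi,\eta\in\mathfrak g$, $g=\tau(\xi)$: $\mathrm d_\xi\tau^{-1}(\eta):=\mathrm D\tau^{-1}(g)\cdot(\eta g)$, with dual $[\mathrm d_\xi\tau^{-1}]^*:\mathfrak g^*\to\mathfrak g^*$. $\langle\mathrm{Ad}^*_g\mu,\eta\rangle=\langle\mu,\mathrm{Ad}_g\eta\rangle$. The Lie–Poisson bracket is $\{f,g\}(\mu)=-\langle\mu,[\frac{\delta f}{\delta\mu},\frac{\delta g}{\delta\mu}]\rangle$; its Casimirs are taken to be functions constant on coadjoint orbits. Reduced scheme. Let $\Delta t>0$, $M\ge1$, $T=M\Delta t$, and $\Delta W^i_k$ ($k=1,\dots,M$) the increments of independent Wiener processes over the $k$-th step (everything is pathwise). The unknowns are $\tilde\mu^1_k,\tilde\mu^2_k\in\mathfrak g^*$, $k=1,\dots,M$, with $$\tilde\xi_k=\xi_k=\tfrac12\tfrac{\partial h}{\partial\mu}\Big(\tfrac{\tilde\mu^1_k+\tilde\mu^2_k}2\Big)+\tfrac12\sum_{i=1}^N\tfrac{\partial h_i}{\partial\mu}\Big(\tfrac{\tilde\mu^1_k+\tilde\mu^2_k}2\Big)\tfrac{\Delta W^i_k}{\Delta t},$$ $$\mathrm{Ad}^*_{\tau(\Delta t\tilde\xi_k)}[\mathrm d_{\Delta t\tilde\xi_k}\tau^{-1}]^*\tilde\mu^1_k=[\mathrm d_{\Delta t\xi_k}\tau^{-1}]^*\tilde\mu^2_k\quad(k=1,\dots,M),$$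 $$\mathrm{Ad}^*_{\tau(\Delta t\xi_k)}[\mathrm d_{\Delta t\xi_k}\tau^{-1}]^*\tilde\mu^2_k=[\mathrm d_{\Delta t\tilde\xi_{k+1}}\tau^{-1}]^*\tilde\mu^1_{k+1}\quad(k=1,\dots,M-1).$$ The trivialized momenta are $$\mu_k=[\mathrm d_{\Delta t\tilde\xi_{k+1}}\tau^{-1}]^*\tilde\mu^1_{k+1}\ (0\le k\le M-1),\qquad \mu_k=\mathrm{Ad}^*_{\tau(\Delta t\xi_k)}[\mathrm d_{\Delta t\xi_k}\tau^{-1}]^*\tilde\mu^2_k\ (1\le k\le M)$$ (the two expressions agree for $1\le k\le M-1$ by the scheme). Standing assumption: the implicit equations are solvable, with $\Delta t\xi_k,\Delta t\tilde\xi_k$ in the neighbourhood of $0$ where $\tau$ is a diffeomorphism, so that $\mathcal F^{\rm red}_{0,T}(\mu_0)=\mu_M$ is defined. *)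

theory Defs
  imports "HOL-Probability.Probability" "HOL-Algebra.Group"
begin

section \<open>Smooth manifolds modelled on a finite-dimensional normed space\<close>

text \<open>On an open set of a finite-dimensional space, iterating directional derivatives as below
  gives the usual classes of k times continuously differentiable maps.\<close>

primrec Ck_on :: "nat \<Rightarrow> ('a::real_normed_vector \<Rightarrow> 'b::real_normed_vector) \<Rightarrow> 'a set \<Rightarrow> bool" where
  "Ck_on 0 f S \<longleftrightarrow> continuous_on S f"
| "Ck_on (Suc k) f S \<longleftrightarrow>
     (\<forall>x\<in>S. f differentiable (at x)) \<and> (\<forall>v. Ck_on k (\<lambda>x. frechet_derivative f (at x) v) S)"

definition smooth_on :: "('a::real_normed_vector \<Rightarrow> 'b::real_normed_vector) \<Rightarrow> 'a set \<Rightarrow> bool" where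
  "smooth_on f S \<longleftrightarrow> (\<forall>k. Ck_on k f S)"

text \<open>A chart is a domain together with a coordinate map; outside its domain the coordinate map
  is irrelevant.  The model space is a normed space with a finite spanning set rather than a
  \<open>euclidean_space\<close>, so that dimension 0 (discrete groups) is included.\<close>

type_synonym ('m, 'e) chart = "'m set \<times> ('m \<Rightarrow> 'e)"

definition smooth_manifold ::
  "'m topology \<Rightarrow> ('m, 'e::real_normed_vector) chart set \<Rightarrow> bool" where
  "smooth_manifold T A \<longleftrightarrow>
     (\<exists>B::'e set. finite B \<and> span B = UNIV) \<and>
     Hausdorff_space T \<and> second_countable T \<and>
     (\<Union>(U, \<phi>)\<in>A. U) = topspace T \<and>
     (\<forall>(U, \<phi>)\<in>A. openin T U \<and> open (\<phi> ` U) \<and>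
        homeomorphic_map (subtopology T U) (top_of_set (\<phi> ` U)) \<phi>) \<and>
     (\<forall>(U, \<phi>)\<in>A. \<forall>(V, \<psi>)\<in>A. smooth_on (\<psi> \<circ> inv_into U \<phi>) (\<phi> ` (U \<inter> V)))"

definition vec_atlas :: "('e, 'e::real_normed_vector) chart set" where
  "vec_atlas = {(UNIV, \<lambda>x. x)}"

definition prod_atlas ::
  "('m, 'a) chart set \<Rightarrow> ('n, 'b) chart set \<Rightarrow> ('m \<times> 'n, 'a \<times> 'b) chart set" where
  "prod_atlas A B = {(U \<times> V, map_prod \<phi> \<psi>) | U V \<phi> \<psi>. (U, \<phi>) \<in> A \<and> (V, \<psi>) \<in> B}"

definition smooth_map_on ::
  "('m, 'a::real_normed_vector) chart set \<Rightarrow> ('n, 'b::real_normed_vector) chart set \<Rightarrow>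
   'm set \<Rightarrow> ('m \<Rightarrow> 'n) \<Rightarrow> bool" where
  "smooth_map_on A B S f \<longleftrightarrow>
     (\<forall>p\<in>S. \<exists>(U, \<phi>)\<in>A. \<exists>(V, \<psi>)\<in>B. \<exists>W. p \<in> W \<and> W \<subseteq> U \<inter> S \<and> open (\<phi> ` W) \<and>
        f ` W \<subseteq> V \<and> smooth_on (\<psi> \<circ> f \<circ> inv_into U \<phi>) (\<phi> ` W))"

text \<open>The tangent space at each point \<open>p\<close> is the model space \<open>'e\<close>: a vector stands for the tangent
  vector at \<open>p\<close> having these coordinates in a chart around \<open>p\<close> chosen once and for all.  The tangent
  map of \<open>f\<close> at \<open>p\<close> is the derivative of \<open>f\<close> read in the chosen charts at \<open>p\<close> and \<open>f p\<close>.\<close>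

definition chart_at :: "('m, 'e) chart set \<Rightarrow> 'm \<Rightarrow> ('m, 'e) chart" where
  "chart_at A p = (SOME c. c \<in> A \<and> p \<in> fst c)"

definition tangent_map ::
  "('m, 'a::real_normed_vector) chart set \<Rightarrow> ('n, 'b::real_normed_vector) chart set \<Rightarrow>
   ('m \<Rightarrow> 'n) \<Rightarrow> 'm \<Rightarrow> 'a \<Rightarrow> 'b" where
  "tangent_map A B f p =
     (let (U, \<phi>) = chart_at A p; (V, \<psi>) = chart_at B (f p)
      in frechet_derivative (\<psi> \<circ> f \<circ> inv_into U \<phi>) (at (\<phi> p)))"

section \<open>Lie groups, the adjoint and coadjoint actions\<close>

locale lie_group = group G for G :: "('g, 'c) monoid_scheme" (structure) +
  fixes T :: "'g topology" and A :: "('g, 'e::real_normed_vector) chart set"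
  assumes topspace_eq: "topspace T = carrier G"
    and manifold: "smooth_manifold T A"
    and smooth_mult:
      "smooth_map_on (prod_atlas A A) A (carrier G \<times> carrier G) (\<lambda>(x, y). x \<otimes> y)"
    and smooth_inv: "smooth_map_on A A (carrier G) (\<lambda>x. m_inv G x)"

text \<open>The Lie algebra is the tangent space at the identity, hence the type \<open>'e\<close>.  Its dual is the
  type of bounded linear functionals, i.e. all linear functionals as \<open>'e\<close> is finite-dimensional;
  the pairing of \<open>\<mu>\<close> and \<open>\<eta>\<close> is the application \<open>\<mu> \<eta>\<close>.\<close>

type_synonym 'e dual = "'e \<Rightarrow>\<^sub>L real"

definition dual_map ::
  "('a::real_normed_vector \<Rightarrow> 'b::real_normed_vector) \<Rightarrow> 'b dual \<Rightarrow> 'a dual" where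
  "dual_map L \<mu> = Blinfun (\<lambda>v. blinfun_apply \<mu> (L v))"

definition Ad ::
  "('g, 'c) monoid_scheme \<Rightarrow> ('g, 'e::real_normed_vector) chart set \<Rightarrow> 'g \<Rightarrow> 'e \<Rightarrow> 'e" where
  "Ad G A g = tangent_map A A (\<lambda>x. g \<otimes>\<^bsub>G\<^esub> x \<otimes>\<^bsub>G\<^esub> inv\<^bsub>G\<^esub> g) \<one>\<^bsub>G\<^esub>"

definition Ad_star ::
  "('g, 'c) monoid_scheme \<Rightarrow> ('g, 'e::real_normed_vector) chart set \<Rightarrow>
   'g \<Rightarrow> 'e dual \<Rightarrow> 'e dual" where
  "Ad_star G A g = dual_map (Ad G A g)"

definition coadjoint_orbit ::
  "('g, 'c) monoid_scheme \<Rightarrow> ('g, 'e::real_normed_vector) chart set \<Rightarrow>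
   'e dual \<Rightarrow> 'e dual set" where
  "coadjoint_orbit G A \<mu> = {Ad_star G A g \<mu> | g. g \<in> carrier G}"

text \<open>Convention: the Casimir functions of the Lie--Poisson bracket are taken to be the functions
  constant on coadjoint orbits.\<close>

definition casimir ::
  "('g, 'c) monoid_scheme \<Rightarrow> ('g, 'e::real_normed_vector) chart set \<Rightarrow>
   ('e dual \<Rightarrow> real) \<Rightarrow> bool" where
  "casimir G A C \<longleftrightarrow> (\<forall>\<mu>. \<forall>\<nu>\<in>coadjoint_orbit G A \<mu>. C \<nu> = C \<mu>)"

text \<open>A function on the cotangent bundle takes a base point \<open>q\<close> and a covector at \<open>q\<close>.  The
  cotangent lift of left translation by \<open>g\<close> sends a covector \<open>p\<close> at \<open>q\<close> to the pullback of \<open>p\<close>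
  under left translation by the inverse of \<open>g\<close>, a covector at \<open>g \<otimes> q\<close>.\<close>

definition left_invariant ::
  "('g, 'c) monoid_scheme \<Rightarrow> ('g, 'e::real_normed_vector) chart set \<Rightarrow>
   ('g \<Rightarrow> 'e dual \<Rightarrow> real) \<Rightarrow> bool" where
  "left_invariant G A H \<longleftrightarrow> (\<forall>g\<in>carrier G. \<forall>q\<in>carrier G. \<forall>p.
     H (g \<otimes>\<^bsub>G\<^esub> q) (dual_map (tangent_map A A (\<lambda>x. inv\<^bsub>G\<^esub> g \<otimes>\<^bsub>G\<^esub> x) (g \<otimes>\<^bsub>G\<^esub> q)) p) = H q p)"

text \<open>By left invariance \<open>H\<close> is determined by its restriction to the dual of the Lie algebra, and
  it is smooth iff that restriction is.\<close>

definition reduced_hamiltonian ::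
  "('g, 'c) monoid_scheme \<Rightarrow> ('g \<Rightarrow> 'e::real_normed_vector dual \<Rightarrow> real) \<Rightarrow>
   'e dual \<Rightarrow> real" where
  "reduced_hamiltonian G H \<mu> = H \<one>\<^bsub>G\<^esub> \<mu>"

text \<open>The derivative of \<open>h\<close> at \<open>\<mu>\<close>, a functional on the dual, as an element of the Lie algebra.\<close>

definition dual_gradient ::
  "('e::real_normed_vector dual \<Rightarrow> real) \<Rightarrow> 'e dual \<Rightarrow> 'e" where
  "dual_gradient h \<mu> = (THE \<xi>. (h has_derivative (\<lambda>\<nu>. blinfun_apply \<nu> \<xi>)) (at \<mu>))"

section \<open>Retraction maps\<close>

text \<open>\<open>U\<close> is a neighbourhood of 0 on which \<open>\<tau>\<close> is a diffeomorphism onto its open image.\<close>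

definition lie_retraction_map ::
  "('g, 'c) monoid_scheme \<Rightarrow> 'g topology \<Rightarrow> ('g, 'e::real_normed_vector) chart set \<Rightarrow>
   ('e \<Rightarrow> 'g) \<Rightarrow> 'e set \<Rightarrow> bool" where
  "lie_retraction_map G T A \<tau> U \<longleftrightarrow>
     range \<tau> \<subseteq> carrier G \<and> \<tau> 0 = \<one>\<^bsub>G\<^esub> \<and>
     open U \<and> 0 \<in> U \<and> inj_on \<tau> U \<and> openin T (\<tau> ` U) \<and>
     smooth_map_on vec_atlas A U \<tau> \<and> smooth_map_on A vec_atlas (\<tau> ` U) (inv_into U \<tau>)"

text \<open>\<open>d\<^sub>\<xi>\<tau>\<inverse>(\<eta>) = D\<tau>\<inverse>(g) (\<eta> g)\<close> with \<open>g = \<tau>(\<xi>)\<close>, where \<open>\<eta> g\<close> is the image of \<open>\<eta>\<close> under the tangent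
  map at the identity of right translation by \<open>g\<close>.\<close>

definition d_tau_inv ::
  "('g, 'c) monoid_scheme \<Rightarrow> ('g, 'e::real_normed_vector) chart set \<Rightarrow>
   ('e \<Rightarrow> 'g) \<Rightarrow> 'e set \<Rightarrow> 'e \<Rightarrow> 'e \<Rightarrow> 'e" where
  "d_tau_inv G A \<tau> U \<xi> \<eta> =
     tangent_map A vec_atlas (inv_into U \<tau>) (\<tau> \<xi>)
       (tangent_map A A (\<lambda>x. x \<otimes>\<^bsub>G\<^esub> \<tau> \<xi>) \<one>\<^bsub>G\<^esub> \<eta>)"

definition d_tau_inv_star ::
  "('g, 'c) monoid_scheme \<Rightarrow> ('g, 'e::real_normed_vector) chart set \<Rightarrow>
   ('e \<Rightarrow> 'g) \<Rightarrow> 'e set \<Rightarrow> 'e \<Rightarrow> 'e dual \<Rightarrow> 'e dual" where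
  "d_tau_inv_star G A \<tau> U \<xi> = dual_map (d_tau_inv G A \<tau> U \<xi>)"

section \<open>Wiener processes\<close>

definition wiener_process :: "'w measure \<Rightarrow> (real \<Rightarrow> 'w \<Rightarrow> real) \<Rightarrow> bool" where
  "wiener_process P W \<longleftrightarrow>
     (\<forall>t\<ge>0. W t \<in> borel_measurable P) \<and>
     (AE \<omega> in P. W 0 \<omega> = 0) \<and>
     (\<forall>s t. 0 \<le> s \<and> s < t \<longrightarrow>
        distributed P lborel (\<lambda>\<omega>. W t \<omega> - W s \<omega>) (normal_density 0 (sqrt (t - s)))) \<and>
     (\<forall>(n::nat) t. 0 \<le> t 0 \<and> (\<forall>k<n. t k \<le> t (Suc k)) \<longrightarrow>
        prob_space.indep_vars P (\<lambda>_. borel) (\<lambda>k \<omega>. W (t (Suc k)) \<omega> - W (t k) \<omega>) {..<n}) \<and>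
     (AE \<omega> in P. continuous_on {0..} (\<lambda>t. W t \<omega>))"

definition independent_wiener_processes ::
  "'w measure \<Rightarrow> nat \<Rightarrow> (nat \<Rightarrow> real \<Rightarrow> 'w \<Rightarrow> real) \<Rightarrow> bool" where
  "independent_wiener_processes P N W \<longleftrightarrow>
     (\<forall>i\<in>{1..N}. wiener_process P (W i)) \<and>
     prob_space.indep_vars P (\<lambda>_. \<Pi>\<^sub>M t\<in>{0..}. borel) (\<lambda>i \<omega>. \<lambda>t\<in>{0..}. W i t \<omega>) {1..N}"

text \<open>Increment of the i-th process over the k-th step (\<open>k \<ge> 1\<close>) along the sample path \<open>\<omega>\<close>.\<close>

definition increment ::
  "(nat \<Rightarrow> real \<Rightarrow> 'w \<Rightarrow> real) \<Rightarrow> real \<Rightarrow> 'w \<Rightarrow> nat \<Rightarrow> nat \<Rightarrow> real" where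
  "increment W dt \<omega> i k = W i (real k * dt) \<omega> - W i ((real k - 1) * dt) \<omega>"

section \<open>The reduced stochastic midpoint scheme\<close>

text \<open>The stage velocities \<open>\<xi>\<^sub>k\<close> and \<open>\<xi>\<^sub>k\<close>-tilde of the scheme coincide; both are \<open>stage_velocity\<close>.
  The arguments \<open>m1\<close> and \<open>m2\<close> are the two sequences of unknowns.\<close>

definition stage_velocity ::
  "('e::real_normed_vector dual \<Rightarrow> real) \<Rightarrow> (nat \<Rightarrow> 'e dual \<Rightarrow> real) \<Rightarrow>
   nat \<Rightarrow> real \<Rightarrow> (nat \<Rightarrow> nat \<Rightarrow> real) \<Rightarrow>
   (nat \<Rightarrow> 'e dual) \<Rightarrow> (nat \<Rightarrow> 'e dual) \<Rightarrow> nat \<Rightarrow> 'e" where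
  "stage_velocity h hs N dt dW m1 m2 k =
     (let mid = (1/2) *\<^sub>R (m1 k + m2 k)
      in (1/2) *\<^sub>R dual_gradient h mid +
         (1/2) *\<^sub>R (\<Sum>i=1..N. (dW i k / dt) *\<^sub>R dual_gradient (hs i) mid))"

definition reduced_scheme ::
  "('g, 'c) monoid_scheme \<Rightarrow> ('g, 'e::real_normed_vector) chart set \<Rightarrow>
   ('e \<Rightarrow> 'g) \<Rightarrow> 'e set \<Rightarrow>
   ('e dual \<Rightarrow> real) \<Rightarrow> (nat \<Rightarrow> 'e dual \<Rightarrow> real) \<Rightarrow>
   nat \<Rightarrow> nat \<Rightarrow> real \<Rightarrow> (nat \<Rightarrow> nat \<Rightarrow> real) \<Rightarrow>
   (nat \<Rightarrow> 'e dual) \<Rightarrow> (nat \<Rightarrow> 'e dual) \<Rightarrow> bool" where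
  "reduced_scheme G A \<tau> U h hs N M dt dW m1 m2 \<longleftrightarrow>
     (let x = (\<lambda>k. dt *\<^sub>R stage_velocity h hs N dt dW m1 m2 k) in
      (\<forall>k\<in>{1..M}. x k \<in> U) \<and>
      (\<forall>k\<in>{1..M}.
         Ad_star G A (\<tau> (x k)) (d_tau_inv_star G A \<tau> U (x k) (m1 k)) =
         d_tau_inv_star G A \<tau> U (x k) (m2 k)) \<and>
      (\<forall>k\<in>{1..<M}.
         Ad_star G A (\<tau> (x k)) (d_tau_inv_star G A \<tau> U (x k) (m2 k)) =
         d_tau_inv_star G A \<tau> U (x (k + 1)) (m1 (k + 1))))"

definition trivialized_momenta ::
  "('g, 'c) monoid_scheme \<Rightarrow> ('g, 'e::real_normed_vector) chart set \<Rightarrow>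
   ('e \<Rightarrow> 'g) \<Rightarrow> 'e set \<Rightarrow>
   ('e dual \<Rightarrow> real) \<Rightarrow> (nat \<Rightarrow> 'e dual \<Rightarrow> real) \<Rightarrow>
   nat \<Rightarrow> nat \<Rightarrow> real \<Rightarrow> (nat \<Rightarrow> nat \<Rightarrow> real) \<Rightarrow>
   (nat \<Rightarrow> 'e dual) \<Rightarrow> (nat \<Rightarrow> 'e dual) \<Rightarrow> (nat \<Rightarrow> 'e dual) \<Rightarrow> bool" where
  "trivialized_momenta G A \<tau> U h hs N M dt dW m1 m2 \<mu> \<longleftrightarrow>
     (let x = (\<lambda>k. dt *\<^sub>R stage_velocity h hs N dt dW m1 m2 k) in
      (\<forall>k<M. \<mu> k = d_tau_inv_star G A \<tau> U (x (k + 1)) (m1 (k + 1))) \<and>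
      (\<forall>k\<in>{1..M}. \<mu> k = Ad_star G A (\<tau> (x k)) (d_tau_inv_star G A \<tau> U (x k) (m2 k))))"

text \<open>\<open>F\<close> is a discrete flow map over the \<open>M\<close> steps with domain \<open>D\<close>: from every initial momentum
  in \<open>D\<close> the implicit equations have a solution, and \<open>F\<close> returns its final momentum.\<close>

definition discrete_flow ::
  "('g, 'c) monoid_scheme \<Rightarrow> ('g, 'e::real_normed_vector) chart set \<Rightarrow>
   ('e \<Rightarrow> 'g) \<Rightarrow> 'e set \<Rightarrow>
   ('e dual \<Rightarrow> real) \<Rightarrow> (nat \<Rightarrow> 'e dual \<Rightarrow> real) \<Rightarrow>
   nat \<Rightarrow> nat \<Rightarrow> real \<Rightarrow> (nat \<Rightarrow> nat \<Rightarrow> real) \<Rightarrow>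
   'e dual set \<Rightarrow> ('e dual \<Rightarrow> 'e dual) \<Rightarrow> bool" where
  "discrete_flow G A \<tau> U h hs N M dt dW D F \<longleftrightarrow>
     (\<forall>\<mu>0\<in>D. \<exists>m1 m2 \<mu>.
        reduced_scheme G A \<tau> U h hs N M dt dW m1 m2 \<and>
        trivialized_momenta G A \<tau> U h hs N M dt dW m1 m2 \<mu> \<and>
        \<mu> 0 = \<mu>0 \<and> F \<mu>0 = \<mu> M)"

end

theory Submission
  imports Defs
begin

text \<open>
  Why the theorem holds: each step of the scheme moves the trivialized momentum by a coadjoint
  transformation.  Put \<open>g = \<tau>(\<Delta>t \<xi>\<^sub>k)\<close>, the group element shared by both stages of step \<open>k\<close>.  Writing
  \<open>d\<^sup>*\<close> for the common map \<open>[d \<tau>\<inverse>]\<^sup>*\<close> at \<open>\<Delta>t \<xi>\<^sub>k\<close>, the old momentum is \<open>d\<^sup>* \<mu>\<^sup>1\<close>, the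
  internal equation turns it into \<open>d\<^sup>* \<mu>\<^sup>2 = Ad\<^sup>*\<^sub>g d\<^sup>* \<mu>\<^sup>1\<close>, and the new momentum is
  \<open>Ad\<^sup>*\<^sub>g d\<^sup>* \<mu>\<^sup>2\<close>.  Hence \<open>\<mu>\<^sub>k = Ad\<^sup>*\<^sub>g Ad\<^sup>*\<^sub>g \<mu>\<^sub>k\<^sub>-\<^sub>1\<close>: the velocity \<open>\<xi>\<^sub>k\<close>,
  and with it the Hamiltonians and the noise along the sample path, enters only through \<open>g\<close>.

  The conclusion then rests on \<open>Ad\<^sup>*\<close> being a right action, \<open>Ad\<^sup>*\<^sub>h Ad\<^sup>*\<^sub>g = Ad\<^sup>*\<^sub>g\<^sub>h\<close>
  (\<open>Ad_star_mult\<close>).  Algebraically this is the identity \<open>c\<^sub>g\<^sub>h = c\<^sub>g \<circ> c\<^sub>h\<close> for conjugations, and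
  the analytic content is the chain rule for tangent maps at the identity (\<open>tangent_map_comp\<close>).
  The chain rule needs conjugations to be differentiable in the charts chosen at the identity, whereas
  smoothness of the multiplication only provides some charts.  Most of the development
  is therefore the chart independence of differentiability (\<open>chart_differentiableI\<close>).
\<close>

section \<open>Charts of a smooth manifold\<close>

lemma smooth_manifoldD:
  assumes "smooth_manifold T A"
  shows "topspace T = (\<Union>(U, \<phi>)\<in>A. U)"
    and "(U, \<phi>) \<in> A \<Longrightarrow> openin T U"
    and "(U, \<phi>) \<in> A \<Longrightarrow> open (\<phi> ` U)"
    and "(U, \<phi>) \<in> A \<Longrightarrow>
      homeomorphic_map (subtopology T U) (top_of_set (\<phi> ` U)) \<phi>"
    and "(U, \<phi>) \<in> A \<Longrightarrow> (V, \<psi>) \<in> A \<Longrightarrow>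
      smooth_on (\<psi> \<circ> inv_into U \<phi>) (\<phi> ` (U \<inter> V))"
  using assms by (auto simp: smooth_manifold_def)

lemma chart_inj_on:
  assumes "smooth_manifold T A" "(U, \<phi>) \<in> A"
  shows "inj_on \<phi> U"
proof -
  have "openin T U" and "homeomorphic_map (subtopology T U) (top_of_set (\<phi> ` U)) \<phi>"
    using smooth_manifoldD[OF assms(1)] assms(2) by auto
  moreover have "topspace (subtopology T U) = U"
    using openin_subset[OF \<open>openin T U\<close>] by auto
  ultimately show ?thesis
    using homeomorphic_imp_injective_map by fastforce
qed

lemma chart_overlap_open:
  assumes M: "smooth_manifold T A" and U: "(U, \<phi>) \<in> A" and V: "(V, \<psi>) \<in> A"
  shows "open (\<phi> ` (U \<inter> V))"
proof -
  have hom: "homeomorphic_map (subtopology T U) (top_of_set (\<phi> ` U)) \<phi>"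
    and op: "open (\<phi> ` U)" and "openin T V"
    using smooth_manifoldD[OF M] U V by auto
  have "openin (subtopology T U) (U \<inter> V)"
    using \<open>openin T V\<close> by (simp add: openin_subtopology_Int2)
  then have "openin (top_of_set (\<phi> ` U)) (\<phi> ` (U \<inter> V))"
    using homeomorphic_imp_open_map[OF hom] unfolding open_map_def by blast
  then show ?thesis
    using op openin_open_eq by blast
qed

lemma chart_range_open:
  assumes "smooth_manifold T A" "(U, \<phi>) \<in> A"
  shows "open (\<phi> ` U)"
  using chart_overlap_open[OF assms assms(2)] by simp

lemma chart_subset_topspace:
  assumes "smooth_manifold T A" "(U, \<phi>) \<in> A"
  shows "U \<subseteq> topspace T"
  using smooth_manifoldD(2)[OF assms] by (rule openin_subset)

lemma chart_at_point:
  assumes "smooth_manifold T A" "p \<in> topspace T"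
  shows "chart_at A p \<in> A" "p \<in> fst (chart_at A p)"
proof -
  have "p \<in> (\<Union>(U, \<phi>)\<in>A. U)"
    using assms smooth_manifoldD(1) by metis
  then have "\<exists>c. c \<in> A \<and> p \<in> fst c" by force
  then have "chart_at A p \<in> A \<and> p \<in> fst (chart_at A p)"
    unfolding chart_at_def by (rule someI_ex)
  then show "chart_at A p \<in> A" "p \<in> fst (chart_at A p)" by auto
qed

lemma smooth_on_differentiable:
  assumes "smooth_on f S" "x \<in> S"
  shows "f differentiable (at x)"
proof -
  have "Ck_on (Suc 0) f S" using assms(1) unfolding smooth_on_def ..
  then show ?thesis using assms(2) by simp
qed

lemma transition_differentiable:
  assumes M: "smooth_manifold T A" and U: "(U, \<phi>) \<in> A" and V: "(V, \<psi>) \<in> A"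
    and p: "p \<in> U" "p \<in> V"
  shows "(\<psi> \<circ> inv_into U \<phi>) differentiable (at (\<phi> p))"
proof -
  have "smooth_on (\<psi> \<circ> inv_into U \<phi>) (\<phi> ` (U \<inter> V))"
    using M U V by (rule smooth_manifoldD(5))
  moreover have "\<phi> p \<in> \<phi> ` (U \<inter> V)" using p by simp
  ultimately show ?thesis by (rule smooth_on_differentiable)
qed

lemma differentiable_tendsto_nhds:
  assumes "F differentiable (at x)"
  shows "filterlim F (nhds (F x)) (nhds x)"
  using differentiable_imp_continuous_within[OF assms]
  unfolding continuous_within tendsto_at_iff_tendsto_nhds .

lemma has_derivative_cong_nhds:
  assumes "(F has_derivative D) (at x)" "\<forall>\<^sub>F y in nhds x. F y = F' y"
  shows "(F' has_derivative D) (at x)"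
  using assms(1)
proof (rule has_derivative_transform_eventually)
  show "\<forall>\<^sub>F y in at x. F y = F' y"
    unfolding eventually_at_filter using assms(2) by (rule eventually_mono) simp
  show "F x = F' x"
    using assms(2) by (rule eventually_nhds_x_imp_x)
qed simp

lemma differentiable_cong_nhds:
  assumes "F differentiable (at x)" "\<forall>\<^sub>F y in nhds x. F y = F' y"
  shows "F' differentiable (at x)"
  using assms has_derivative_cong_nhds unfolding differentiable_def by blast

lemma frechet_derivative_cong_nhds:
  assumes "F differentiable (at x)" "\<forall>\<^sub>F y in nhds x. F y = F' y"
  shows "frechet_derivative F' (at x) = frechet_derivative F (at x)"
proof -
  have "(F has_derivative frechet_derivative F (at x)) (at x)"
    using assms(1) frechet_derivative_works by blast
  then have "(F' has_derivative frechet_derivative F (at x)) (at x)"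
    using assms(2) by (rule has_derivative_cong_nhds)
  then show ?thesis
    by (rule frechet_derivative_at[symmetric])
qed

section \<open>Differentiability at a point and the chain rule for tangent maps\<close>

text \<open>
  The first conjunct turns continuity of the coordinate expression into continuity of \<open>f\<close> at \<open>p\<close>.
  It has to be stated, as the coordinate map \<open>\<psi>\<close> carries no information outside its domain.
  Quantifying over all charts makes the chain rule and the passage to \<open>chart_at\<close> immediate.
\<close>

definition chart_differentiable ::
  "('m, 'a::real_normed_vector) chart set \<Rightarrow> ('n, 'b::real_normed_vector) chart set \<Rightarrow>
   ('m \<Rightarrow> 'n) \<Rightarrow> 'm \<Rightarrow> bool" where
  "chart_differentiable A B f p \<longleftrightarrow>
     (\<forall>U \<phi> V \<psi>. (U, \<phi>) \<in> A \<longrightarrow> (V, \<psi>) \<in> B \<longrightarrow> p \<in> U \<longrightarrow> f p \<in> V \<longrightarrow>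
        (\<forall>\<^sub>F y in nhds (\<phi> p). f (inv_into U \<phi> y) \<in> V) \<and>
        (\<psi> \<circ> f \<circ> inv_into U \<phi>) differentiable (at (\<phi> p)))"

lemma chart_differentiableD:
  assumes "chart_differentiable A B f p"
    and "(U, \<phi>) \<in> A" "(V, \<psi>) \<in> B" "p \<in> U" "f p \<in> V"
  shows "\<forall>\<^sub>F y in nhds (\<phi> p). f (inv_into U \<phi> y) \<in> V"
    and "(\<psi> \<circ> f \<circ> inv_into U \<phi>) differentiable (at (\<phi> p))"
  using assms unfolding chart_differentiable_def by blast+

text \<open>
  Chart independence: near \<open>p\<close>, the expression of \<open>f\<close> in any other pair of charts is the
  given one composed with a transition map on either side.
\<close>

lemma chart_differentiableI:
  assumes MA: "smooth_manifold TA A" and MB: "smooth_manifold TB B"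
    and U: "(U, \<phi>) \<in> A" and V: "(V, \<psi>) \<in> B" and p: "p \<in> U" and fp: "f p \<in> V"
    and near: "\<forall>\<^sub>F y in nhds (\<phi> p). f (inv_into U \<phi> y) \<in> V"
    and diff: "(\<psi> \<circ> f \<circ> inv_into U \<phi>) differentiable (at (\<phi> p))"
  shows "chart_differentiable A B f p"
  unfolding chart_differentiable_def
proof (intro allI impI)
  fix U' \<phi>' V' \<psi>'
  assume U': "(U', \<phi>') \<in> A" and V': "(V', \<psi>') \<in> B" and p': "p \<in> U'" and fp': "f p \<in> V'"
  note inj = chart_inj_on[OF MA U] chart_inj_on[OF MA U'] chart_inj_on[OF MB V]
  define F where "F = \<psi> \<circ> f \<circ> inv_into U \<phi>"
  define s where "s = \<phi> \<circ> inv_into U' \<phi>'"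
  define t where "t = \<psi>' \<circ> inv_into V \<psi>"
  have s_p: "s (\<phi>' p) = \<phi> p" and F_p: "F (\<phi> p) = \<psi> (f p)"
    using inj p p' by (auto simp: s_def F_def)
  have s: "s differentiable (at (\<phi>' p))"
    unfolding s_def by (rule transition_differentiable[OF MA U' U p' p])
  have t: "t differentiable (at (\<psi> (f p)))"
    unfolding t_def by (rule transition_differentiable[OF MB V V' fp fp'])
  have near_V': "\<forall>\<^sub>F y in nhds (\<phi> p). f (inv_into U \<phi> y) \<in> V \<inter> V'"
  proof -
    have "\<forall>\<^sub>F z in nhds (\<psi> (f p)). z \<in> \<psi> ` (V \<inter> V')"
      using chart_overlap_open[OF MB V V'] fp fp' by (intro eventually_nhds_in_open) auto
    then have "\<forall>\<^sub>F y in nhds (\<phi> p). F y \<in> \<psi> ` (V \<inter> V')"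
      using differentiable_tendsto_nhds[OF diff] F_p
      unfolding F_def[symmetric] filterlim_iff by auto
    with near show ?thesis
    proof eventually_elim
      case (elim y)
      then show ?case
        using inj(3) unfolding F_def by (auto simp: inj_on_def)
    qed
  qed
  have overlap: "\<forall>\<^sub>F y in nhds (\<phi>' p). y \<in> \<phi>' ` (U' \<inter> U)"
    using chart_overlap_open[OF MA U' U] p p' by (intro eventually_nhds_in_open) auto
  have pulled: "\<forall>\<^sub>F y in nhds (\<phi>' p). f (inv_into U \<phi> (s y)) \<in> V \<inter> V'"
    using differentiable_tendsto_nhds[OF s] near_V' s_p unfolding filterlim_iff by auto
  have both: "\<forall>\<^sub>F y in nhds (\<phi>' p). f (inv_into U' \<phi>' y) \<in> V' \<and>
      (t \<circ> F \<circ> s) y = (\<psi>' \<circ> f \<circ> inv_into U' \<phi>') y"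
    using overlap pulled
  proof eventually_elim
    case (elim y)
    then obtain x where x: "x \<in> U'" "x \<in> U" "y = \<phi>' x" by auto
    then have "inv_into U \<phi> (s y) = x" "inv_into U' \<phi>' y = x"
      using inj by (auto simp: s_def)
    then show ?case
      using elim inj(3) by (auto simp: t_def F_def)
  qed
  show "(\<forall>\<^sub>F y in nhds (\<phi>' p). f (inv_into U' \<phi>' y) \<in> V') \<and>
      (\<psi>' \<circ> f \<circ> inv_into U' \<phi>') differentiable (at (\<phi>' p))"
  proof
    show "\<forall>\<^sub>F y in nhds (\<phi>' p). f (inv_into U' \<phi>' y) \<in> V'"
      using both by (rule eventually_mono) auto
    have "(F \<circ> s) differentiable (at (\<phi>' p))"
      using s diff s_p by (intro differentiable_chain_at) (auto simp: F_def)
    then have "(t \<circ> (F \<circ> s)) differentiable (at (\<phi>' p))"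
      by (rule differentiable_chain_at) (simp add: s_p F_p t)
    then show "(\<psi>' \<circ> f \<circ> inv_into U' \<phi>') differentiable (at (\<phi>' p))"
    proof (rule differentiable_cong_nhds)
      show "\<forall>\<^sub>F y in nhds (\<phi>' p).
          (t \<circ> (F \<circ> s)) y = (\<psi>' \<circ> f \<circ> inv_into U' \<phi>') y"
        using both by (rule eventually_mono) auto
    qed
  qed
qed

text \<open>
  Membership in the middle chart, guaranteed near \<open>p\<close> by the continuity part of
  \<open>chart_differentiable\<close>, is what lets the two coordinate expressions be composed.
\<close>

lemma coordinate_comp_eventually:
  assumes MB: "smooth_manifold TB B" and f: "chart_differentiable A B f p"
    and U: "(U, \<phi>) \<in> A" and V: "(V, \<psi>) \<in> B" and p: "p \<in> U" and fp: "f p \<in> V"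
  shows "\<forall>\<^sub>F y in nhds (\<phi> p).
     ((\<zeta> \<circ> g \<circ> inv_into V \<psi>) \<circ> (\<psi> \<circ> f \<circ> inv_into U \<phi>)) y = (\<zeta> \<circ> (g \<circ> f) \<circ> inv_into U \<phi>) y"
  using chart_differentiableD(1)[OF f U V p fp]
  by (rule eventually_mono) (use chart_inj_on[OF MB V] in simp)

lemma chart_differentiable_comp:
  assumes MA: "smooth_manifold TA A" and MB: "smooth_manifold TB B" and MC: "smooth_manifold TC C"
    and f: "chart_differentiable A B f p" and g: "chart_differentiable B C g (f p)"
    and p: "p \<in> topspace TA" and fp: "f p \<in> topspace TB" and gfp: "g (f p) \<in> topspace TC"
  shows "chart_differentiable A C (g \<circ> f) p"
proof -
  obtain U \<phi> where U: "(U, \<phi>) \<in> A" "p \<in> U"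
    using chart_at_point[OF MA p] by (metis prod.collapse)
  obtain V \<psi> where V: "(V, \<psi>) \<in> B" "f p \<in> V"
    using chart_at_point[OF MB fp] by (metis prod.collapse)
  obtain Z \<zeta> where Z: "(Z, \<zeta>) \<in> C" "g (f p) \<in> Z"
    using chart_at_point[OF MC gfp] by (metis prod.collapse)
  define F where "F = \<psi> \<circ> f \<circ> inv_into U \<phi>"
  define G where "G = \<zeta> \<circ> g \<circ> inv_into V \<psi>"
  have inv_p: "inv_into U \<phi> (\<phi> p) = p"
    using chart_inj_on[OF MA U(1)] U(2) by simp
  have F: "F differentiable (at (\<phi> p))" and F_p: "F (\<phi> p) = \<psi> (f p)"
    and nearF: "\<forall>\<^sub>F y in nhds (\<phi> p). f (inv_into U \<phi> y) \<in> V"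
    using chart_differentiableD[OF f U(1) V(1) U(2) V(2)] inv_p by (auto simp: F_def)
  have G: "G differentiable (at (\<psi> (f p)))"
    and nearG: "\<forall>\<^sub>F z in nhds (\<psi> (f p)). g (inv_into V \<psi> z) \<in> Z"
    using chart_differentiableD[OF g V(1) Z(1) V(2) Z(2)] by (auto simp: G_def)
  show ?thesis
  proof (rule chart_differentiableI[OF MA MC U(1) Z(1) U(2)])
    show "(g \<circ> f) p \<in> Z" using Z(2) by simp
    have "\<forall>\<^sub>F y in nhds (\<phi> p). g (inv_into V \<psi> (F y)) \<in> Z"
      using differentiable_tendsto_nhds[OF F] nearG F_p unfolding filterlim_iff by auto
    then show "\<forall>\<^sub>F y in nhds (\<phi> p). (g \<circ> f) (inv_into U \<phi> y) \<in> Z"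
      using nearF by eventually_elim (use chart_inj_on[OF MB V(1)] in \<open>simp add: F_def\<close>)
    have "(G \<circ> F) differentiable (at (\<phi> p))"
      using F G F_p by (intro differentiable_chain_at) auto
    then show "(\<zeta> \<circ> (g \<circ> f) \<circ> inv_into U \<phi>) differentiable (at (\<phi> p))"
      using coordinate_comp_eventually[OF MB f U(1) V(1) U(2) V(2), of \<zeta> g]
      unfolding F_def G_def by (rule differentiable_cong_nhds)
  qed
qed

lemma tangent_map_cong:
  assumes MA: "smooth_manifold TA A" and MB: "smooth_manifold TB B"
    and f: "chart_differentiable A B f p" and p: "p \<in> topspace TA" and fp: "f p \<in> topspace TB"
    and eq: "\<And>x. x \<in> topspace TA \<Longrightarrow> f x = f' x"
  shows "tangent_map A B f' p = tangent_map A B f p"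
proof -
  obtain U \<phi> where c: "chart_at A p = (U, \<phi>)" and U: "(U, \<phi>) \<in> A" "p \<in> U"
    using chart_at_point[OF MA p] by (cases "chart_at A p") auto
  obtain V \<psi> where d: "chart_at B (f p) = (V, \<psi>)" and V: "(V, \<psi>) \<in> B" "f p \<in> V"
    using chart_at_point[OF MB fp] by (cases "chart_at B (f p)") auto
  have "\<forall>\<^sub>F y in nhds (\<phi> p). y \<in> \<phi> ` U"
    using chart_range_open[OF MA U(1)] U(2) by (intro eventually_nhds_in_open) auto
  then have "\<forall>\<^sub>F y in nhds (\<phi> p). f (inv_into U \<phi> y) = f' (inv_into U \<phi> y)"
    by (rule eventually_mono)
      (use eq chart_subset_topspace[OF MA U(1)] in \<open>meson inv_into_into subsetD\<close>)
  then have same': "\<forall>\<^sub>F y in nhds (\<phi> p).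
      (\<psi> \<circ> f \<circ> inv_into U \<phi>) y = (\<psi> \<circ> f' \<circ> inv_into U \<phi>) y"
    by (rule eventually_mono) simp
  note D = chart_differentiableD[OF f U(1) V(1) U(2) V(2)]
  show "tangent_map A B f' p = tangent_map A B f p"
    using frechet_derivative_cong_nhds[OF D(2) same'] eq[OF p]
    unfolding tangent_map_def eq[OF p, symmetric] c d by (simp del: comp_apply)
qed

lemma tangent_map_bounded_linear:
  assumes MA: "smooth_manifold TA A" and MB: "smooth_manifold TB B"
    and f: "chart_differentiable A B f p" and p: "p \<in> topspace TA" and fp: "f p \<in> topspace TB"
  shows "bounded_linear (tangent_map A B f p)"
proof -
  obtain U \<phi> where c: "chart_at A p = (U, \<phi>)" and U: "(U, \<phi>) \<in> A" "p \<in> U"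
    using chart_at_point[OF MA p] by (cases "chart_at A p") auto
  obtain V \<psi> where d: "chart_at B (f p) = (V, \<psi>)" and V: "(V, \<psi>) \<in> B" "f p \<in> V"
    using chart_at_point[OF MB fp] by (cases "chart_at B (f p)") auto
  show ?thesis
    using chart_differentiableD(2)[OF f U(1) V(1) U(2) V(2)]
    unfolding tangent_map_def c d
    by (auto simp: frechet_derivative_works dest: has_derivative_bounded_linear)
qed

lemma tangent_map_comp:
  assumes MA: "smooth_manifold TA A" and MB: "smooth_manifold TB B" and MC: "smooth_manifold TC C"
    and f: "chart_differentiable A B f p" and g: "chart_differentiable B C g (f p)"
    and p: "p \<in> topspace TA" and fp: "f p \<in> topspace TB" and gfp: "g (f p) \<in> topspace TC"
  shows "tangent_map A C (g \<circ> f) p = tangent_map B C g (f p) \<circ> tangent_map A B f p"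
proof -
  obtain U \<phi> where c: "chart_at A p = (U, \<phi>)" and U: "(U, \<phi>) \<in> A" "p \<in> U"
    using chart_at_point[OF MA p] by (cases "chart_at A p") auto
  obtain V \<psi> where d: "chart_at B (f p) = (V, \<psi>)" and V: "(V, \<psi>) \<in> B" "f p \<in> V"
    using chart_at_point[OF MB fp] by (cases "chart_at B (f p)") auto
  obtain Z \<zeta> where e: "chart_at C (g (f p)) = (Z, \<zeta>)" and Z: "(Z, \<zeta>) \<in> C" "g (f p) \<in> Z"
    using chart_at_point[OF MC gfp] by (cases "chart_at C (g (f p))") auto
  define F where "F = \<psi> \<circ> f \<circ> inv_into U \<phi>"
  define G where "G = \<zeta> \<circ> g \<circ> inv_into V \<psi>"
  have F: "F differentiable (at (\<phi> p))"
    using chart_differentiableD(2)[OF f U(1) V(1) U(2) V(2)] by (simp add: F_def)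
  have F_p: "F (\<phi> p) = \<psi> (f p)"
    using chart_inj_on[OF MA U(1)] U(2) by (simp add: F_def)
  have G: "G differentiable (at (F (\<phi> p)))"
    using chart_differentiableD(2)[OF g V(1) Z(1) V(2) Z(2)] F_p by (simp add: G_def)
  have "frechet_derivative (\<zeta> \<circ> (g \<circ> f) \<circ> inv_into U \<phi>) (at (\<phi> p))
      = frechet_derivative (G \<circ> F) (at (\<phi> p))"
    using coordinate_comp_eventually[OF MB f U(1) V(1) U(2) V(2), of \<zeta> g] F G
    unfolding F_def G_def
    by (intro frechet_derivative_cong_nhds differentiable_chain_at)
  also have "\<dots> = frechet_derivative G (at (F (\<phi> p))) \<circ> frechet_derivative F (at (\<phi> p))"
    using F G by (rule frechet_derivative_compose)
  finally show ?thesis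
    using c d e F_p by (simp add: tangent_map_def F_def G_def)
qed

section \<open>The adjoint and coadjoint actions\<close>

text \<open>
  \<open>Blinfun\<close> represents its argument only when that is bounded linear, hence the assumption: it
  makes the inner \<open>dual_map\<close> the genuine pullback.
\<close>

lemma dual_map_comp:
  assumes K: "bounded_linear K"
  shows "dual_map (K \<circ> L) \<mu> = dual_map L (dual_map K \<mu>)"
proof -
  have "bounded_linear (\<lambda>v. blinfun_apply \<mu> (K v))"
    using bounded_linear_compose[OF blinfun.bounded_linear_right K] .
  then show ?thesis
    by (simp add: dual_map_def bounded_linear_Blinfun_apply)
qed

context lie_group
begin

text \<open>
  A product chart splits into its factors: injectivity of both coordinate maps lets the inverse
  of the product chart be computed componentwise.
\<close>

lemma mult_charts:
  assumes g: "g \<in> carrier G" and x: "x \<in> carrier G"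
  obtains U \<phi> V \<psi> Z \<zeta> where "(U, \<phi>) \<in> A" "(V, \<psi>) \<in> A" "(Z, \<zeta>) \<in> A"
    and "g \<in> U" "x \<in> V" "g \<otimes> x \<in> Z"
    and "\<forall>\<^sub>F z in nhds (\<phi> g, \<psi> x). inv_into U \<phi> (fst z) \<otimes> inv_into V \<psi> (snd z) \<in> Z"
    and "(\<lambda>z. \<zeta> (inv_into U \<phi> (fst z) \<otimes> inv_into V \<psi> (snd z)))
      differentiable (at (\<phi> g, \<psi> x))"
proof -
  have "\<exists>(UV, \<theta>)\<in>prod_atlas A A. \<exists>(Z, \<zeta>)\<in>A. \<exists>W. (g, x) \<in> W \<and>
      W \<subseteq> UV \<inter> (carrier G \<times> carrier G) \<and> open (\<theta> ` W) \<and> (\<lambda>(x, y). x \<otimes> y) ` W \<subseteq> Z \<and>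
      smooth_on (\<zeta> \<circ> (\<lambda>(x, y). x \<otimes> y) \<circ> inv_into UV \<theta>) (\<theta> ` W)"
    using smooth_mult g x unfolding smooth_map_on_def by blast
  then obtain UV \<theta> Z \<zeta> W where UV: "(UV, \<theta>) \<in> prod_atlas A A" and Z: "(Z, \<zeta>) \<in> A"
    and W: "(g, x) \<in> W" "W \<subseteq> UV" "open (\<theta> ` W)" "(\<lambda>(x, y). x \<otimes> y) ` W \<subseteq> Z"
    and sm: "smooth_on (\<zeta> \<circ> (\<lambda>(x, y). x \<otimes> y) \<circ> inv_into UV \<theta>) (\<theta> ` W)"
    by auto
  from UV obtain U \<phi> V \<psi> where U: "(U, \<phi>) \<in> A" and V: "(V, \<psi>) \<in> A"
    and UV_eq: "UV = U \<times> V" and \<theta>_eq: "\<theta> = map_prod \<phi> \<psi>"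
    unfolding prod_atlas_def by auto
  note inj = chart_inj_on[OF manifold U] chart_inj_on[OF manifold V]
  have inj_\<theta>: "inj_on \<theta> UV"
    using inj unfolding \<theta>_eq UV_eq by (rule map_prod_inj_on)
  then have on_W: "inv_into UV \<theta> (\<theta> w) = w \<and> inv_into U \<phi> (fst (\<theta> w)) = fst w \<and>
      inv_into V \<psi> (snd (\<theta> w)) = snd w" if "w \<in> W" for w
  proof -
    have "w \<in> UV" using that W(2) by blast
    then show ?thesis
      using inv_into_f_f[OF inj_\<theta>] inj by (auto simp: UV_eq \<theta>_eq)
  qed
  have in_W: "(\<phi> g, \<psi> x) \<in> \<theta> ` W"
    using imageI[OF W(1), of \<theta>] by (simp add: \<theta>_eq)
  have near: "\<forall>\<^sub>F z in nhds (\<phi> g, \<psi> x). z \<in> \<theta> ` W"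
    using W(3) in_W by (rule eventually_nhds_in_open)
  show thesis
  proof (rule that[OF U V Z])
    show "g \<in> U" "x \<in> V" "g \<otimes> x \<in> Z"
      using W(1,2,4) UV_eq by auto
    show "\<forall>\<^sub>F z in nhds (\<phi> g, \<psi> x). inv_into U \<phi> (fst z) \<otimes> inv_into V \<psi> (snd z) \<in> Z"
      using near by (rule eventually_mono) (use on_W W(4) in \<open>force\<close>)
    from sm in_W have "(\<zeta> \<circ> (\<lambda>(x, y). x \<otimes> y) \<circ> inv_into UV \<theta>) differentiable (at (\<phi> g, \<psi> x))"
      by (rule smooth_on_differentiable)
    moreover have "\<forall>\<^sub>F z in nhds (\<phi> g, \<psi> x). (\<zeta> \<circ> (\<lambda>(x, y). x \<otimes> y) \<circ> inv_into UV \<theta>) z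
        = \<zeta> (inv_into U \<phi> (fst z) \<otimes> inv_into V \<psi> (snd z))"
      using near by (rule eventually_mono) (use on_W in \<open>auto simp: case_prod_beta\<close>)
    ultimately show "(\<lambda>z. \<zeta> (inv_into U \<phi> (fst z) \<otimes> inv_into V \<psi> (snd z)))
        differentiable (at (\<phi> g, \<psi> x))"
      by (rule differentiable_cong_nhds)
  qed
qed

text \<open>
  A translation is the multiplication with one argument held fixed; in the product charts this
  is composition with an affine embedding of the model space as a slice.
\<close>

lemma left_translation_differentiable:
  assumes g: "g \<in> carrier G" and x: "x \<in> carrier G"
  shows "chart_differentiable A A (\<lambda>y. g \<otimes> y) x"
proof -
  obtain U \<phi> V \<psi> Z \<zeta> where ch: "(U, \<phi>) \<in> A" "(V, \<psi>) \<in> A" "(Z, \<zeta>) \<in> A"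
    and pts: "g \<in> U" "x \<in> V" "g \<otimes> x \<in> Z"
    and near: "\<forall>\<^sub>F z in nhds (\<phi> g, \<psi> x). inv_into U \<phi> (fst z) \<otimes> inv_into V \<psi> (snd z) \<in> Z"
    and diff: "(\<lambda>z. \<zeta> (inv_into U \<phi> (fst z) \<otimes> inv_into V \<psi> (snd z)))
      differentiable (at (\<phi> g, \<psi> x))"
    using mult_charts[OF g x] .
  have inv_g: "inv_into U \<phi> (\<phi> g) = g"
    using chart_inj_on[OF manifold ch(1)] pts(1) by simp
  have slice: "(\<lambda>y. (\<phi> g, y)) differentiable (at (\<psi> x))"
    unfolding differentiable_def by (auto intro!: derivative_eq_intros exI)
  show ?thesis
  proof (rule chart_differentiableI[where f = "\<lambda>y. g \<otimes> y" and p = x, OF manifold manifold ch(2,3) pts(2,3)])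
    show "\<forall>\<^sub>F y in nhds (\<psi> x). g \<otimes> inv_into V \<psi> y \<in> Z"
      using differentiable_tendsto_nhds[OF slice] near inv_g unfolding filterlim_iff by force
    show "(\<zeta> \<circ> (\<lambda>y. g \<otimes> y) \<circ> inv_into V \<psi>) differentiable (at (\<psi> x))"
      using differentiable_chain_at[OF slice diff] inv_g by (simp add: o_def)
  qed
qed

lemma right_translation_differentiable:
  assumes g: "g \<in> carrier G" and x: "x \<in> carrier G"
  shows "chart_differentiable A A (\<lambda>y. y \<otimes> g) x"
proof -
  obtain U \<phi> V \<psi> Z \<zeta> where ch: "(U, \<phi>) \<in> A" "(V, \<psi>) \<in> A" "(Z, \<zeta>) \<in> A"
    and pts: "x \<in> U" "g \<in> V" "x \<otimes> g \<in> Z"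
    and near: "\<forall>\<^sub>F z in nhds (\<phi> x, \<psi> g). inv_into U \<phi> (fst z) \<otimes> inv_into V \<psi> (snd z) \<in> Z"
    and diff: "(\<lambda>z. \<zeta> (inv_into U \<phi> (fst z) \<otimes> inv_into V \<psi> (snd z)))
      differentiable (at (\<phi> x, \<psi> g))"
    using mult_charts[OF x g] .
  have inv_g: "inv_into V \<psi> (\<psi> g) = g"
    using chart_inj_on[OF manifold ch(2)] pts(2) by simp
  have slice: "(\<lambda>y. (y, \<psi> g)) differentiable (at (\<phi> x))"
    unfolding differentiable_def by (auto intro!: derivative_eq_intros exI)
  show ?thesis
  proof (rule chart_differentiableI[where f = "\<lambda>y. y \<otimes> g" and p = x, OF manifold manifold ch(1,3) pts(1,3)])
    show "\<forall>\<^sub>F y in nhds (\<phi> x). inv_into U \<phi> y \<otimes> g \<in> Z"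
      using differentiable_tendsto_nhds[OF slice] near inv_g unfolding filterlim_iff by force
    show "(\<zeta> \<circ> (\<lambda>y. y \<otimes> g) \<circ> inv_into U \<phi>) differentiable (at (\<phi> x))"
      using differentiable_chain_at[OF slice diff] inv_g by (simp add: o_def)
  qed
qed

lemma conjugation_differentiable:
  assumes g: "g \<in> carrier G" and x: "x \<in> carrier G"
  shows "chart_differentiable A A (\<lambda>y. g \<otimes> y \<otimes> inv g) x"
proof -
  have "chart_differentiable A A ((\<lambda>y. y \<otimes> inv g) \<circ> (\<lambda>y. g \<otimes> y)) x"
    using g x
    by (intro chart_differentiable_comp[OF manifold manifold manifold]
        left_translation_differentiable right_translation_differentiable)
      (auto simp: topspace_eq)
  then show ?thesis by (simp add: o_def)
qed

lemma Ad_bounded_linear: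
  assumes "g \<in> carrier G"
  shows "bounded_linear (Ad G A g)"
  unfolding Ad_def using assms conjugation_differentiable[OF assms one_closed]
  by (intro tangent_map_bounded_linear[OF manifold manifold]) (auto simp: topspace_eq)

text \<open>
  Conjugations fix the identity and compose like the group elements, so the chain rule applies
  within the single tangent space at the identity.
\<close>

lemma Ad_mult:
  assumes g: "g \<in> carrier G" and h: "h \<in> carrier G"
  shows "Ad G A (g \<otimes> h) = Ad G A g \<circ> Ad G A h"
proof -
  let ?c = "\<lambda>g x. g \<otimes> x \<otimes> inv g"
  have fix1: "?c k \<one> = \<one>" if "k \<in> carrier G" for k
    using that by simp
  have eq: "?c (g \<otimes> h) x = (?c g \<circ> ?c h) x" if "x \<in> carrier G" for x
    using that g h by (simp add: inv_mult_group m_assoc)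
  have "Ad G A (g \<otimes> h) = tangent_map A A (?c g \<circ> ?c h) \<one>"
    unfolding Ad_def
    by (rule tangent_map_cong[OF manifold manifold
          conjugation_differentiable, symmetric])
      (use g h eq in \<open>auto simp: topspace_eq\<close>)
  also have "\<dots> = tangent_map A A (?c g) (?c h \<one>) \<circ> tangent_map A A (?c h) \<one>"
    using g h by (intro tangent_map_comp[OF manifold manifold manifold] conjugation_differentiable)
      (auto simp: topspace_eq)
  finally show ?thesis
    using fix1[OF h] by (simp add: Ad_def)
qed

lemma Ad_star_mult:
  assumes "g \<in> carrier G" "h \<in> carrier G"
  shows "Ad_star G A (g \<otimes> h) \<mu> = Ad_star G A h (Ad_star G A g \<mu>)"
  using assms unfolding Ad_star_def
  by (simp add: Ad_mult dual_map_comp Ad_bounded_linear)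

lemma coadjoint_orbit_eq:
  assumes "\<nu> \<in> coadjoint_orbit G A \<mu>"
  shows "coadjoint_orbit G A \<nu> = coadjoint_orbit G A \<mu>"
proof -
  obtain g where g: "g \<in> carrier G" and \<nu>: "\<nu> = Ad_star G A g \<mu>"
    using assms unfolding coadjoint_orbit_def by auto
  show ?thesis
  proof
    show "coadjoint_orbit G A \<nu> \<subseteq> coadjoint_orbit G A \<mu>"
      unfolding coadjoint_orbit_def \<nu> using g by (auto simp flip: Ad_star_mult)
    show "coadjoint_orbit G A \<mu> \<subseteq> coadjoint_orbit G A \<nu>"
    proof
      fix \<kappa> assume "\<kappa> \<in> coadjoint_orbit G A \<mu>"
      then obtain k where k: "k \<in> carrier G" and \<kappa>: "\<kappa> = Ad_star G A k \<mu>"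
        unfolding coadjoint_orbit_def by auto
      have "k = g \<otimes> (inv g \<otimes> k)"
        using g k by (simp flip: m_assoc)
      then have "\<kappa> = Ad_star G A (inv g \<otimes> k) \<nu>"
        using g k \<kappa> \<nu> by (metis Ad_star_mult inv_closed m_closed)
      then show "\<kappa> \<in> coadjoint_orbit G A \<nu>"
        using g k unfolding coadjoint_orbit_def by auto
    qed
  qed
qed

section \<open>One step of the scheme\<close>

text \<open>
  Both stages of a step use the same group element \<open>g\<close>, so the step acts on the momentum as
  \<open>Ad\<^sup>*\<close> of \<open>g \<otimes> g\<close>.
\<close>

lemma trivialized_momenta_step:
  assumes \<tau>: "range \<tau> \<subseteq> carrier G"
    and sch: "reduced_scheme G A \<tau> U h hs N M dt dW m1 m2"
    and mom: "trivialized_momenta G A \<tau> U h hs N M dt dW m1 m2 \<mu>"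
    and k: "k < M"
  shows "\<mu> (Suc k) \<in> coadjoint_orbit G A (\<mu> k)"
proof -
  define x where "x = dt *\<^sub>R stage_velocity h hs N dt dW m1 m2 (Suc k)"
  have g: "\<tau> x \<in> carrier G" using \<tau> by auto
  have "\<mu> k = d_tau_inv_star G A \<tau> U x (m1 (Suc k))"
    and "\<mu> (Suc k) = Ad_star G A (\<tau> x) (d_tau_inv_star G A \<tau> U x (m2 (Suc k)))"
    using mom k by (auto simp: trivialized_momenta_def Let_def x_def)
  moreover have "Ad_star G A (\<tau> x) (d_tau_inv_star G A \<tau> U x (m1 (Suc k)))
      = d_tau_inv_star G A \<tau> U x (m2 (Suc k))"
    using sch k by (auto simp: reduced_scheme_def Let_def x_def)
  ultimately have "\<mu> (Suc k) = Ad_star G A (\<tau> x \<otimes> \<tau> x) (\<mu> k)"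
    using g by (simp add: Ad_star_mult)
  then show ?thesis
    using g unfolding coadjoint_orbit_def by auto
qed

lemma trivialized_momenta_invariants:
  assumes "range \<tau> \<subseteq> carrier G"
    and "reduced_scheme G A \<tau> U h hs N M dt dW m1 m2"
    and "trivialized_momenta G A \<tau> U h hs N M dt dW m1 m2 \<mu>"
    and "k \<le> M"
  shows "coadjoint_orbit G A (\<mu> k) = coadjoint_orbit G A (\<mu> 0)"
    and "casimir G A C \<Longrightarrow> C (\<mu> k) = C (\<mu> 0)"
proof -
  note step = trivialized_momenta_step[OF assms(1-3)]
  have "coadjoint_orbit G A (\<mu> k) = coadjoint_orbit G A (\<mu> 0) \<and>
      (casimir G A C \<longrightarrow> C (\<mu> k) = C (\<mu> 0))"
    using \<open>k \<le> M\<close>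
  proof (induction k)
    case (Suc k)
    then have "\<mu> (Suc k) \<in> coadjoint_orbit G A (\<mu> k)"
      by (intro step) auto
    moreover from this have "coadjoint_orbit G A (\<mu> (Suc k)) = coadjoint_orbit G A (\<mu> k)"
      by (rule coadjoint_orbit_eq)
    ultimately show ?case
      using Suc by (auto simp: casimir_def)
  qed simp
  then show "coadjoint_orbit G A (\<mu> k) = coadjoint_orbit G A (\<mu> 0)"
    and "casimir G A C \<Longrightarrow> C (\<mu> k) = C (\<mu> 0)" by auto
qed

end

section \<open>Preservation of coadjoint orbits by the discrete flow\<close>

theorem proposition4p3:
  fixes G :: "('g, 'c) monoid_scheme" and T :: "'g topology"
    and A :: "('g, 'e::real_normed_vector) chart set"
    and \<tau> :: "'e \<Rightarrow> 'g" and U :: "'e set"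
    and H :: "'g \<Rightarrow> 'e dual \<Rightarrow> real" and Hs :: "nat \<Rightarrow> 'g \<Rightarrow> 'e dual \<Rightarrow> real"
    and h :: "'e dual \<Rightarrow> real" and hs :: "nat \<Rightarrow> 'e dual \<Rightarrow> real"
    and N M :: nat and dt :: real
    and P :: "'w measure" and W :: "nat \<Rightarrow> real \<Rightarrow> 'w \<Rightarrow> real"
  assumes "lie_group G T A"
    and "lie_retraction_map G T A \<tau> U"
    and "left_invariant G A H" and "\<forall>i\<in>{1..N}. left_invariant G A (Hs i)"
    and "h = reduced_hamiltonian G H" and "\<forall>i\<in>{1..N}. hs i = reduced_hamiltonian G (Hs i)"
    and "smooth_on h UNIV" and "\<forall>i\<in>{1..N}. smooth_on (hs i) UNIV"
    and "dt > 0" and "M \<ge> 1"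
    and "prob_space P" and "independent_wiener_processes P N W"
  shows "\<forall>\<omega>\<in>space P.
    (\<forall>m1 m2 \<mu>.
       reduced_scheme G A \<tau> U h hs N M dt (increment W dt \<omega>) m1 m2 \<longrightarrow>
       trivialized_momenta G A \<tau> U h hs N M dt (increment W dt \<omega>) m1 m2 \<mu> \<longrightarrow>
       (\<forall>k\<le>M. coadjoint_orbit G A (\<mu> k) = coadjoint_orbit G A (\<mu> 0)) \<and>
       (\<forall>C. casimir G A C \<longrightarrow> (\<forall>k\<le>M. C (\<mu> k) = C (\<mu> 0)))) \<and>
    (\<forall>D F. discrete_flow G A \<tau> U h hs N M dt (increment W dt \<omega>) D F \<longrightarrow>
       (\<forall>\<mu>0\<in>D. coadjoint_orbit G A (F \<mu>0) = coadjoint_orbit G A \<mu>0 \<and>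
          (\<forall>C. casimir G A C \<longrightarrow> C (F \<mu>0) = C \<mu>0)))"
proof (intro ballI conjI allI impI)
  interpret lie_group G T A by fact
  have \<tau>: "range \<tau> \<subseteq> carrier G"
    using \<open>lie_retraction_map G T A \<tau> U\<close> by (simp add: lie_retraction_map_def)
  note inv = trivialized_momenta_invariants[OF \<tau>]
  fix \<omega>
  {
    fix m1 m2 \<mu> k
    assume "reduced_scheme G A \<tau> U h hs N M dt (increment W dt \<omega>) m1 m2"
      and "trivialized_momenta G A \<tau> U h hs N M dt (increment W dt \<omega>) m1 m2 \<mu>" and "k \<le> M"
    note inv = inv[OF this]
    show "coadjoint_orbit G A (\<mu> k) = coadjoint_orbit G A (\<mu> 0)"
      by (rule inv(1))
    show "C (\<mu> k) = C (\<mu> 0)" if "casimir G A C" for C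
      using that by (rule inv(2))
  }
  {
    fix D F \<mu>0
    assume "discrete_flow G A \<tau> U h hs N M dt (increment W dt \<omega>) D F" and "\<mu>0 \<in> D"
    then obtain m1 m2 \<mu> where sol:
        "reduced_scheme G A \<tau> U h hs N M dt (increment W dt \<omega>) m1 m2"
        "trivialized_momenta G A \<tau> U h hs N M dt (increment W dt \<omega>) m1 m2 \<mu>"
      and ends: "\<mu> 0 = \<mu>0" "F \<mu>0 = \<mu> M"
      unfolding discrete_flow_def by blast
    note inv = inv[OF sol order_refl]
    show "coadjoint_orbit G A (F \<mu>0) = coadjoint_orbit G A \<mu>0"
      using inv(1) ends by simp
    show "C (F \<mu>0) = C \<mu>0" if "casimir G A C" for C
      using inv(2)[OF that] ends by simp
  }
qed

end
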